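(* Let $l$ and $d$ be positive integers, and let $A$ be an associative $l$-generated algebra over a field satisfying the identity $x^{d}=0$. Then the nilpotency index of $A$ is less than $\Psi(d,d,l)$, where $$\Psi(n,d,l)=4^{5+3\log_3 4}\, l\, (nd)^{3 \log_3 (nd)+(5+6\log_3 4)}\,d^2.$$
   Context: The field is of arbitrary characteristic. The nilpotency index of $A$ is the smallest positive integer $N$ such that every product of $N$ elements of $A$ is zero. *)

theory Defs
  imports Complex_Main
begin

text \<open>Algebras need not have a unit: a nonzero unital algebra never satisfies
  \<open>x\<^sup>d = 0\<close>. The class \<^class>\<open>ring\<close> is the class of associative rings without unit.\<close>

locale assoc_algebra = vector_space scale
  for scale :: "'k::field \<Rightarrow> 'a::ring \<Rightarrow> 'a" +
  assumes scale_mult_left: "scale c x * y = scale c (x * y)"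
    and scale_mult_right: "x * scale c y = scale c (x * y)"

definition subalgebra :: "('k::field \<Rightarrow> 'a::ring \<Rightarrow> 'a) \<Rightarrow> 'a set \<Rightarrow> bool" where
  "subalgebra scale S \<longleftrightarrow> module.subspace scale S \<and> (\<forall>x\<in>S. \<forall>y\<in>S. x * y \<in> S)"

text \<open>The \<open>l\<close> generators may coincide, so every algebra generated by at most \<open>l\<close> elements
  is \<open>l\<close>-generated when \<open>l > 0\<close>.\<close>

definition generated_by :: "('k::field \<Rightarrow> 'a::ring \<Rightarrow> 'a) \<Rightarrow> nat \<Rightarrow> bool" where
  "generated_by scale l \<longleftrightarrow> (\<exists>g :: nat \<Rightarrow> 'a. subalgebra scale hull (g ` {..<l}) = UNIV)"

text \<open>Without a unit there is no empty product; the value at \<^term>\<open>[]\<close> is a dummy, and only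
  products of positive length are used below.\<close>

fun nonempty_prod :: "'a::ring list \<Rightarrow> 'a" where
  "nonempty_prod [] = 0"
| "nonempty_prod [x] = x"
| "nonempty_prod (x # y # zs) = x * nonempty_prod (y # zs)"

definition nonunital_power :: "'a::ring \<Rightarrow> nat \<Rightarrow> 'a" where
  "nonunital_power x d = nonempty_prod (replicate d x)"

definition products_vanish :: "'a::ring set \<Rightarrow> nat \<Rightarrow> bool" where
  "products_vanish A N \<longleftrightarrow> (\<forall>xs. set xs \<subseteq> A \<and> length xs = N \<longrightarrow> nonempty_prod xs = 0)"

definition nilpotent :: "'a::ring set \<Rightarrow> bool" where
  "nilpotent A \<longleftrightarrow> (\<exists>N>0. products_vanish A N)"

text \<open>Meaningful only if \<^term>\<open>nilpotent A\<close>.\<close>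

definition nilpotency_index :: "'a::ring set \<Rightarrow> nat" where
  "nilpotency_index A = (LEAST N. N > 0 \<and> products_vanish A N)"

definition Psi :: "nat \<Rightarrow> nat \<Rightarrow> nat \<Rightarrow> real" where
  "Psi n d l = 4 powr (5 + 3 * log 3 4) * real l
     * real (n * d) powr (3 * log 3 (real (n * d)) + (5 + 6 * log 3 4)) * real d ^ 2"

end

theory Submission
  imports Defs "HOL-Library.List_Lexorder" "HOL-Library.Multiset"
begin

text \<open>The proof combines Shirshov's reduction of words with a combinatorial statement: a
  word over \<open>l\<close> letters that is long enough is \<open>d\<close>-divisible (it has \<open>d\<close> consecutive factors
  that decrease lexicographically) or contains a \<open>d\<close>-th power.

  The algebraic part is the classical one. Applying \<open>x\<^sup>d = 0\<close> to sums of elements yields the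
  multilinear identity \<open>\<Sum>\<sigma>. x\<^bsub>\<sigma> 1\<^esub> \<cdots> x\<^bsub>\<sigma> d\<^esub> = 0\<close> over every field
  (\<open>linearised_power\<close>). It rewrites a \<open>d\<close>-divisible word in the generators as a combination of
  lexicographically smaller words of the same length, and a word with a \<open>d\<close>-th power is zero
  outright, so by well-founded induction all long words vanish (\<open>long_words_act_zero\<close>).

  The combinatorial part (\<open>divisible_or_power\<close>) works with factors of one length
  \<open>a\<close> at a time. If a word is not \<open>d\<close>-divisible, no \<open>d\<close>
  positions at mutual distance at least \<open>a\<close> carry decreasing factors of length
  \<open>a\<close>. Ranking a position by the longest such chain that ends in it splits the
  positions into at most \<open>d\<close> classes, on each of which the factors at positions at
  least \<open>a\<close> apart never decrease. Hence, among sufficiently many blocks spaced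
  \<open>a\<close> apart, one shows at most \<open>d\<close> distinct factors
  (\<open>interval_with_few_values\<close>): a block with more has two different factors \<open>u
  < u'\<close> of the same rank \<open>r\<close>, and the pair \<open>(r, u)\<close> cannot recur
  in a later block. A factor of length \<open>2 a\<close> is made of two of length
  \<open>a\<close>, so such a block has, apart from a margin at its end, at most
  \<open>d\<^sup>2\<close> factors of length \<open>2 a\<close>, and the pigeonhole argument
  applies again inside it; one doubling shrinks the interval by a factor of about
  \<open>d\<^sup>3\<close>. Once \<open>a \<ge> d\<close>, having at most \<open>d\<close> factors
  of length \<open>a\<close> forces periodicity, as in the theorem of Morse and Hedlund, and thus
  a \<open>d\<close>-th power (\<open>few_factors_has_power\<close>). About \<open>log\<^sub>2
  d\<close> doublings are made, which gives a bound of the form \<open>l d\<^bsup>3 log\<^sub>2 d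
  + O(1)\<^esup>\<close>; since \<open>log\<^sub>2 d \<le> 2 log\<^sub>3 d\<close>, this is below
  \<open>Psi d d l\<close>.\<close>

section \<open>Factors at a fixed scale\<close>

definition factor :: "'b list \<Rightarrow> nat \<Rightarrow> nat \<Rightarrow> 'b list" where
  "factor w a x = take a (drop x w)"

definition descending :: "nat \<Rightarrow> (nat \<Rightarrow> 'v::linorder) \<Rightarrow> nat list \<Rightarrow> bool" where
  "descending a val = sorted_wrt (\<lambda>x y. x + a \<le> y \<and> val y < val x)"

text \<open>The rank of \<open>x\<close> is the length of the longest descending chain that can be continued by \<open>x\<close>;
  it grows along chains because appending \<open>x\<close> to such a chain keeps it descending.\<close>

lemma rank_of_positions:
  fixes val :: "nat \<Rightarrow> 'v::linorder"
  assumes "\<And>xs. set xs \<subseteq> X \<Longrightarrow> descending a val xs \<Longrightarrow> length xs \<noteq> n"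
  obtains r :: "nat \<Rightarrow> nat" where "\<And>x. x \<in> X \<Longrightarrow> r x < n"
    and "\<And>x y. x \<in> X \<Longrightarrow> y \<in> X \<Longrightarrow> x + a \<le> y \<Longrightarrow> val y < val x \<Longrightarrow> r x < r y"
proof -
  have short: "length xs < n" if "set xs \<subseteq> X" "descending a val xs" for xs
  proof (rule ccontr)
    assume "\<not> length xs < n"
    moreover have "descending a val (take n xs)"
      using that(2) unfolding descending_def by (rule sorted_wrt_take)
    moreover have "set (take n xs) \<subseteq> X"
      using that(1) set_take_subset by fastforce
    ultimately show False using assms[of "take n xs"] by simp
  qed
  define P where "P x = {length xs |xs. set xs \<subseteq> X \<and> descending a val (xs @ [x])}" for x
  have P_less: "k < n" if "x \<in> X" "k \<in> P x" for x k
    using that short[of "_ @ [x]"] unfolding P_def by force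
  have fin: "finite (P x)" if "x \<in> X" for x
    using P_less[OF that] by (meson finite_nat_set_iff_bounded)
  have ne: "P x \<noteq> {}" for x
    unfolding P_def descending_def by (auto intro: exI[of _ "[]"])
  show thesis
  proof (rule that[of "\<lambda>x. Max (P x)"])
    show "Max (P x) < n" if "x \<in> X" for x
      using P_less[OF that Max_in[OF fin[OF that] ne]] .
  next
    fix x y assume xy: "x \<in> X" "y \<in> X" "x + a \<le> y" "val y < val x"
    from Max_in[OF fin[OF xy(1)] ne] obtain xs
      where xs: "Max (P x) = length xs" "set xs \<subseteq> X" "descending a val (xs @ [x])"
      unfolding P_def by blast
    have "descending a val ((xs @ [x]) @ [y])"
      using xs(3) xy(3,4) unfolding descending_def by (fastforce simp: sorted_wrt_append)
    then have "length (xs @ [x]) \<in> P y"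
      using xs(2) xy(1) unfolding P_def by (intro CollectI exI[of _ "xs @ [x]"]) auto
    then show "Max (P x) < Max (P y)"
      using Max_ge[OF fin[OF xy(2)]] xs(1) by fastforce
  qed
qed

text \<open>Take \<open>K\<close> blocks of length \<open>L\<close>, each followed by a gap of length \<open>a\<close>. A block with more than
  \<open>n\<close> values contains positions \<open>p\<close> and \<open>q\<close> of equal rank with \<open>val p < val q\<close>. The pair formed
  of the rank and the value of \<open>p\<close> determines the block: if a later block had the same pair at
  \<open>p'\<close>, then \<open>val p' = val p < val q\<close> would make \<open>p'\<close> a successor of \<open>q\<close> in a chain, although
  their ranks agree. There are only \<open>n * M\<close> pairs.\<close>

lemma interval_with_few_values:
  fixes val :: "nat \<Rightarrow> 'v::linorder"
  assumes X: "X = {c..<c + K * (L + a)}"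
    and no_chain: "\<And>xs. set xs \<subseteq> X \<Longrightarrow> descending a val xs \<Longrightarrow> length xs \<noteq> n"
    and few: "card (val ` X) \<le> M" and K: "n * M < K"
  obtains c' where "c \<le> c'" "c' + L \<le> c + K * (L + a)" "card (val ` {c'..<c' + L}) \<le> n"
proof -
  obtain r where r: "\<And>x. x \<in> X \<Longrightarrow> r x < n"
    and r_mono: "\<And>x y. x \<in> X \<Longrightarrow> y \<in> X \<Longrightarrow> x + a \<le> y \<Longrightarrow> val y < val x \<Longrightarrow> r x < r y"
    using rank_of_positions[of X a val n] no_chain by metis
  define B where "B b = {c + b * (L + a)..<c + b * (L + a) + L}" for b
  have BX: "c + b * (L + a) + L \<le> c + K * (L + a)" if "b < K" for b
  proof -
    have "Suc b * (L + a) \<le> K * (L + a)" using that by (intro mult_le_mono1) simp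
    then show ?thesis by simp
  qed
  have B_sub: "B b \<subseteq> X" if "b < K" for b
    using BX[OF that] unfolding B_def X by auto
  have B_apart: "x + a \<le> y" if "x \<in> B b" "y \<in> B b'" "b < b'" for x y b b'
  proof -
    have "Suc b * (L + a) \<le> b' * (L + a)" using that(3) by (intro mult_le_mono1) simp
    then show ?thesis using that(1,2) unfolding B_def by simp
  qed
  have "\<exists>b<K. card (val ` B b) \<le> n"
  proof (rule ccontr)
    assume bad: "\<not> (\<exists>b<K. card (val ` B b) \<le> n)"
    have "\<exists>x y. x \<in> B b \<and> y \<in> B b \<and> r x = r y \<and> val x < val y" if b: "b < K" for b
    proof (rule ccontr)
      assume none: "\<not> ?thesis"
      have "val x = val y" if "x \<in> B b" "y \<in> B b" "r x = r y" for x y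
        using none that by (metis linorder_neqE)
      then have "val ` B b = (\<lambda>k. val (SOME x. x \<in> B b \<and> r x = k)) ` r ` B b"
        unfolding image_image by (intro image_cong refl) (metis (mono_tags, lifting) someI_ex)
      then have "card (val ` B b) \<le> card (r ` B b)"
        by (metis B_def card_image_le finite_atLeastLessThan finite_imageI)
      also have "\<dots> \<le> card {..<n}"
        using B_sub[OF b] r by (intro card_mono) auto
      finally show False using bad b by auto
    qed
    then obtain p q where pq: "\<And>b. b < K \<Longrightarrow> p b \<in> B b" "\<And>b. b < K \<Longrightarrow> q b \<in> B b"
        "\<And>b. b < K \<Longrightarrow> r (p b) = r (q b)" "\<And>b. b < K \<Longrightarrow> val (p b) < val (q b)"
      by metis
    \<comment> \<open>The pigeonhole map from blocks to pairs of a rank and a value.\<close>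
    let ?f = "\<lambda>b. (r (p b), val (p b))"
    have distinct: "?f b \<noteq> ?f b'" if "b < b'" "b' < K" for b b'
    proof
      assume eq: "?f b = ?f b'"
      have b: "b < K" using that by simp
      have "r (q b) < r (p b')"
      proof (rule r_mono)
        show "q b \<in> X" "p b' \<in> X" using pq(1,2) b that(2) B_sub by blast+
        show "q b + a \<le> p b'" using B_apart pq(1,2) b that by blast
        show "val (p b') < val (q b)" using pq(4)[OF b] eq by simp
      qed
      then show False using pq(3)[of b] that eq by simp
    qed
    have "inj_on ?f {..<K}"
      by (rule linorder_inj_onI) (use distinct in auto)
    moreover have "?f ` {..<K} \<subseteq> {..<n} \<times> val ` X"
      using pq B_sub r by blast
    moreover have "finite ({..<n} \<times> val ` X)" using X by simp
    ultimately have "K \<le> card ({..<n} \<times> val ` X)"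
      using card_inj_on_le by fastforce
    also have "\<dots> \<le> n * M" using few by (simp add: card_cartesian_product)
    finally show False using K by simp
  qed
  then obtain b where b: "b < K" "card (val ` B b) \<le> n" by blast
  show thesis
    by (rule that[of "c + b * (L + a)"]) (use b BX in \<open>auto simp: B_def\<close>)
qed

lemma card_factors_double:
  assumes "card (factor w a ` {c..<c + (L + a)}) \<le> m"
  shows "card (factor w (2 * a) ` {c..<c + L}) \<le> m * m"
proof -
  let ?F = "factor w a ` {c..<c + (L + a)}"
  have split: "factor w (2 * a) x = factor w a x @ factor w a (x + a)" for x
    by (simp add: factor_def mult_2 take_add add.commute)
  have "factor w (2 * a) ` {c..<c + L} \<subseteq> (\<lambda>(u, v). u @ v) ` (?F \<times> ?F)"
  proof
    fix z assume "z \<in> factor w (2 * a) ` {c..<c + L}"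
    then obtain x where "x \<in> {c..<c + L}" "z = factor w a x @ factor w a (x + a)"
      using split by auto
    then show "z \<in> (\<lambda>(u, v). u @ v) ` (?F \<times> ?F)"
      by (intro image_eqI[of _ _ "(factor w a x, factor w a (x + a))"]) auto
  qed
  then have "card (factor w (2 * a) ` {c..<c + L}) \<le> card (?F \<times> ?F)"
    by (meson card_image_le card_mono finite_SigmaI finite_atLeastLessThan finite_imageI le_trans)
  also have "\<dots> \<le> m * m"
    using assms by (simp add: card_cartesian_product mult_le_mono)
  finally show ?thesis .
qed

section \<open>Few factors force a power\<close>

text \<open>The number of factors of length \<open>j\<close> starting in the interval is 1 for \<open>j = 0\<close>, does not
  decrease with \<open>j\<close>, and is at most \<open>q \<le> a\<close> for \<open>j = a\<close>. So it is stationary at some \<open>j < a\<close>,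
  which means that a factor of length \<open>j\<close> determines the next letter. The word then runs through
  an automaton with at most \<open>q\<close> states, one of which is visited twice within \<open>q\<close> steps.\<close>

lemma few_factors_periodic:
  assumes card_le: "card (factor w a ` {c..<c + L}) \<le> q" and "q \<le> a" and "q < L"
    and inside: "c + L + a \<le> length w"
  obtains x y where "c \<le> x" "x < y" "y \<le> c + q"
    "\<And>i. y + i < c + L \<Longrightarrow> w ! (x + i) = w ! (y + i)"
proof -
  let ?I = "{c..<c + L}"
  define C where "C j = card (factor w j ` ?I)" for j
  have take_factor: "factor w j x = take j (factor w k x)" if "j \<le> k" for j k x
    using that by (simp add: factor_def min_def)
  have image: "factor w j ` ?I = take j ` factor w k ` ?I" if "j \<le> k" for j k
    unfolding image_image using take_factor[OF that] by simp
  have C_mono: "C j \<le> C k" if "j \<le> k" for j k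
    unfolding C_def image[OF that] by (intro card_image_le) simp
  have "\<exists>j<a. C (Suc j) \<le> C j"
  proof (rule ccontr)
    assume "\<not> ?thesis"
    then have step: "\<And>j. j < a \<Longrightarrow> C j < C (Suc j)" by force
    have "j < C j" if "j \<le> a" for j
      using that
    proof (induction j)
      case 0
      show ?case using \<open>q < L\<close> by (auto simp: C_def card_gt_0_iff)
    next
      case (Suc j)
      then show ?case using step[of j] by simp
    qed
    from this[of a] show False using card_le \<open>q \<le> a\<close> by (simp add: C_def)
  qed
  then obtain j where j: "j < a" "C (Suc j) \<le> C j" by blast
  have "card (take j ` factor w (Suc j) ` ?I) = card (factor w (Suc j) ` ?I)"
    using j(2) C_mono[of j "Suc j"] image[of j "Suc j"] by (simp add: C_def)
  then have inj: "inj_on (take j) (factor w (Suc j) ` ?I)"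
    by (intro eq_card_imp_inj_on) simp_all
  \<comment> \<open>At the stationary length \<open>j\<close>, a factor has only one continuation.\<close>
  have extend: "factor w (Suc j) x = factor w (Suc j) y"
    if "x \<in> ?I" "y \<in> ?I" "factor w j x = factor w j y" for x y
    using inj_onD[OF inj] that take_factor[of j "Suc j"] by (metis imageI le_SucI order_refl)
  have "card (factor w j ` {c..c + q}) \<le> C j"
    unfolding C_def using \<open>q < L\<close> by (intro card_mono image_mono) auto
  also have "\<dots> \<le> q" using C_mono[of j a] j(1) card_le by (simp add: C_def)
  finally have "\<not> inj_on (factor w j) {c..c + q}"
    using card_image[of "factor w j" "{c..c + q}"] by auto
  then obtain x y where xy: "c \<le> x" "x < y" "y \<le> c + q" "factor w j x = factor w j y"
    unfolding inj_on_def by (metis atLeastAtMost_iff linorder_neqE_nat)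
  have same: "factor w j (x + i) = factor w j (y + i)" if "y + i < c + L" for i
    using that
  proof (induction i)
    case 0
    show ?case using xy by simp
  next
    case (Suc i)
    have "factor w (Suc j) (x + i) = factor w (Suc j) (y + i)"
      using Suc xy by (intro extend) auto
    then have "tl (factor w (Suc j) (x + i)) = tl (factor w (Suc j) (y + i))" by simp
    then show ?case by (simp add: factor_def tl_take drop_Suc tl_drop)
  qed
  have "w ! (x + i) = w ! (y + i)" if "y + i < c + L" for i
  proof -
    have "factor w (Suc j) (x + i) = factor w (Suc j) (y + i)"
      using that xy same[OF that] by (intro extend) auto
    then have "factor w (Suc j) (x + i) ! 0 = factor w (Suc j) (y + i) ! 0" by simp
    then show ?thesis using that inside xy by (simp add: factor_def)
  qed
  then show thesis using that xy by blast
qed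

lemma periodic_imp_power:
  assumes "\<And>i. x \<le> i \<Longrightarrow> i + p < x + d * p \<Longrightarrow> w ! i = w ! (i + p)"
    and "x + d * p \<le> length w"
  shows "factor w (d * p) x = concat (replicate d (factor w p x))"
  using assms
proof (induction d)
  case 0
  then show ?case by (simp add: factor_def)
next
  case (Suc d)
  have "factor w (d * p) (x + p) = factor w (d * p) x"
    using Suc.prems
    by (intro nth_equalityI) (auto simp: factor_def add_ac)
  moreover have "factor w (d * p) x = concat (replicate d (factor w p x))"
    using Suc.prems by (intro Suc.IH) auto
  ultimately show ?case by (simp add: factor_def take_add add.commute)
qed

definition has_power :: "nat \<Rightarrow> 'b list \<Rightarrow> bool" where
  "has_power d w \<longleftrightarrow> (\<exists>v u v'. u \<noteq> [] \<and> w = v @ concat (replicate d u) @ v')"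

lemma few_factors_has_power:
  assumes "card (factor w a ` {c..<c + d * (d + 1)}) \<le> d" and "0 < d" "d \<le> a"
    and inside: "c + d * (d + 1) + a \<le> length w"
  shows "has_power d w"
proof -
  have "d < d * (d + 1)" using \<open>0 < d\<close> by simp
  with assms obtain x y where xy: "c \<le> x" "x < y" "y \<le> c + d"
    and eq: "\<And>i. y + i < c + d * (d + 1) \<Longrightarrow> w ! (x + i) = w ! (y + i)"
    by (elim few_factors_periodic) auto
  define p where "p = y - x"
  have p: "0 < p" "y = x + p" "x \<le> c + d - p" "p \<le> d" using xy by (auto simp: p_def)
  have "d * p \<le> d * d" using p by simp
  then have room: "x + d * p \<le> c + d * (d + 1)" using p(3) unfolding distrib_left by linarith
  have "factor w (d * p) x = concat (replicate d (factor w p x))"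
  proof (rule periodic_imp_power)
    fix i assume i: "x \<le> i" "i + p < x + d * p"
    show "w ! i = w ! (i + p)"
      using eq[of "i - x"] i room p by (simp add: add.commute)
  qed (use room inside in simp)
  then have "w = take x w @ concat (replicate d (factor w p x)) @ drop (d * p) (drop x w)"
    by (metis append_take_drop_id factor_def)
  moreover have "factor w p x \<noteq> []"
    using p room inside \<open>d \<le> a\<close> \<open>0 < d\<close> by (auto simp: factor_def)
  ultimately show ?thesis unfolding has_power_def by blast
qed

section \<open>Divisible words\<close>

text \<open>The lexicographic order in which a word and a prefix of it are incomparable. A strict
  comparison in this order survives arbitrary continuations of both words, which is what makes
  permuting the factors of a divisible word decrease it.\<close>

definition dominates :: "'b::linorder list \<Rightarrow> 'b list \<Rightarrow> bool" where
  "dominates u u' \<longleftrightarrow> (\<exists>a. a \<le> length u \<and> a \<le> length u' \<and> take a u' < take a u)"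

definition divisible :: "nat \<Rightarrow> 'b::linorder list \<Rightarrow> bool" where
  "divisible n w \<longleftrightarrow> (\<exists>v us v'. w = v @ concat us @ v' \<and> length us = n \<and> [] \<notin> set us \<and>
     sorted_wrt dominates us)"

text \<open>Cutting the word at the positions of the chain leaves pieces of length at least \<open>a\<close>, so each
  piece contains all of the factor by which its starting position was compared.\<close>

lemma descending_pieces:
  assumes "descending a (factor w a) xs" "xs \<noteq> []" "\<And>x. x \<in> set xs \<Longrightarrow> x + a \<le> length w"
  shows "\<exists>us v'. drop (hd xs) w = concat us @ v' \<and> map (take a) us = map (factor w a) xs
    \<and> (\<forall>u\<in>set us. a \<le> length u)"
  using assms
proof (induction xs rule: induct_list012)
  case (2 x)
  then show ?case
    by (intro exI[of _ "[drop x w]"] exI[of _ "[]"]) (auto simp: factor_def)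
next
  case (3 x y zs)
  from "3.prems" have "descending a (factor w a) (y # zs)" and xy: "x + a \<le> y"
    and y: "y + a \<le> length w"
    by (auto simp: descending_def)
  with "3.IH"(2) "3.prems"(3) obtain us v' where us: "drop y w = concat us @ v'"
    "map (take a) us = map (factor w a) (y # zs)" "\<forall>u\<in>set us. a \<le> length u"
    by fastforce
  have "drop x w = take (y - x) (drop x w) @ drop y w"
    using xy by (metis append_take_drop_id drop_drop le_add_diff_inverse2 add_leD1)
  then show ?case
    using us xy y
    by (intro exI[of _ "take (y - x) (drop x w) # us"] exI[of _ v'])
       (auto simp: factor_def min_def)
qed simp

lemma descending_imp_divisible:
  assumes desc: "descending a (factor w a) xs" and "xs \<noteq> []" and "0 < a"
    and inside: "\<And>x. x \<in> set xs \<Longrightarrow> x + a \<le> length w"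
  shows "divisible (length xs) w"
proof -
  obtain us v' where us: "drop (hd xs) w = concat us @ v'"
    "map (take a) us = map (factor w a) xs" "\<forall>u\<in>set us. a \<le> length u"
    using descending_pieces[OF desc \<open>xs \<noteq> []\<close> inside] by blast
  have len: "length us = length xs" using us(2) by (rule map_eq_imp_length_eq)
  have "sorted_wrt (\<lambda>u u'. u' < u) (map (factor w a) xs)"
    using desc unfolding descending_def sorted_wrt_map
    by (rule sorted_wrt_mono_rel[rotated]) auto
  then have "sorted_wrt (\<lambda>u u'. take a u' < take a u) us"
    unfolding us(2)[symmetric] sorted_wrt_map .
  then have "sorted_wrt dominates us"
    using us(3) by (elim sorted_wrt_mono_rel[rotated]) (auto simp: dominates_def)
  moreover have "[] \<notin> set us" using us(3) \<open>0 < a\<close> by fastforce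
  moreover have "w = take (hd xs) w @ concat us @ v'" using us(1) by (metis append_take_drop_id)
  ultimately show ?thesis using len unfolding divisible_def by blast
qed

text \<open>The length of an interval with at most \<open>d\<close> distinct factors of length \<open>a\<close> from which \<open>t\<close>
  doublings of \<open>a\<close> can be made. One doubling discards the last \<open>a\<close> positions, where a factor of
  length \<open>2 a\<close> would leave the region under control, and then needs more than \<open>d * d\<^sup>2\<close> spaced
  blocks. The last interval has to accommodate \<open>d\<close> periods of length at most \<open>d\<close>, after a
  preperiod of length at most \<open>d\<close>.\<close>

fun sufficient_length :: "nat \<Rightarrow> nat \<Rightarrow> nat \<Rightarrow> nat" where
  "sufficient_length d a 0 = d * (d + 1)"
| "sufficient_length d a (Suc t) =
    a + (d ^ 3 + 1) * (sufficient_length d (2 * a) t + 2 * a)"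

lemma refine_scale:
  assumes "\<not> divisible d w" and "0 < d" and "0 < a"
    and "card (factor w a ` {c..<c + sufficient_length d a t}) \<le> d"
    and "c + sufficient_length d a t + a \<le> length w"
  obtains c' where "card (factor w (2 ^ t * a) ` {c'..<c' + d * (d + 1)}) \<le> d"
    and "c' + d * (d + 1) + 2 ^ t * a \<le> length w"
  using assms(3-) 
proof (induction t arbitrary: a c thesis)
  case 0
  then show ?case by simp
next
  case (Suc t)
  define S K where "S = sufficient_length d (2 * a) t" and "K = d ^ 3 + 1"
  let ?X = "{c..<c + K * (S + 2 * a)}"
  have len: "c + K * (S + 2 * a) + 2 * a \<le> length w"
    using Suc.prems(4) by (simp add: S_def K_def)
  have "card (factor w (2 * a) ` ?X) \<le> d * d"
    by (rule card_factors_double) (use Suc.prems(3) in \<open>simp add: S_def K_def add_ac\<close>)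
  moreover have "d * (d * d) < K" by (simp add: K_def power3_eq_cube)
  moreover have "length xs \<noteq> d"
    if "set xs \<subseteq> ?X" "descending (2 * a) (factor w (2 * a)) xs" for xs
    using descending_imp_divisible[OF that(2)] that(1) assms(1,2) Suc.prems(2) len
    by fastforce
  ultimately obtain c' where c': "c \<le> c'" "c' + S \<le> c + K * (S + 2 * a)"
      "card (factor w (2 * a) ` {c'..<c' + S}) \<le> d"
    using interval_with_few_values[OF refl] by metis
  show ?case
  proof (rule Suc.IH[where a = "2 * a" and c = c'])
    show "card (factor w (2 * a) ` {c'..<c' + sufficient_length d (2 * a) t}) \<le> d"
      using c'(3) by (simp add: S_def)
    show "c' + sufficient_length d (2 * a) t + 2 * a \<le> length w"
      using c'(2) len by (simp add: S_def)
    show "0 < 2 * a" using Suc.prems by simp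
  qed (use Suc.prems(1) in \<open>auto simp: mult_ac\<close>)
qed

text \<open>Factors of length 1 take at most \<open>l\<close> values, so \<open>d * l + 1\<close> blocks suffice to find the first
  interval.\<close>

definition word_bound :: "nat \<Rightarrow> nat \<Rightarrow> nat \<Rightarrow> nat" where
  "word_bound d l t = (d * l + 1) * (sufficient_length d 1 t + 1) + 1"

theorem divisible_or_power:
  fixes w :: "nat list"
  assumes "0 < d" "d \<le> 2 ^ t" and letters: "set w \<subseteq> {..<l}"
    and len: "length w = word_bound d l t"
  shows "divisible d w \<or> has_power d w"
unfolding disj_imp
proof
  assume ndiv: "\<not> divisible d w"
  define S K where "S = sufficient_length d 1 t" and "K = d * l + 1"
  let ?X = "{0..<0 + K * (S + 1)}"
  have inside: "K * (S + 1) + 1 \<le> length w" using len by (simp add: word_bound_def S_def K_def)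
  have "factor w 1 ` ?X \<subseteq> (\<lambda>i. [i]) ` {..<l}"
  proof
    fix z assume "z \<in> factor w 1 ` ?X"
    then obtain x where x: "x < K * (S + 1)" "z = factor w 1 x" by auto
    have "x < length w" using x(1) inside by linarith
    moreover from this have "z = [w ! x]" using x(2) by (simp add: factor_def take_Suc hd_drop_conv_nth)
    ultimately show "z \<in> (\<lambda>i. [i]) ` {..<l}" using letters nth_mem by blast
  qed
  then have "card (factor w 1 ` ?X) \<le> l"
    using surj_card_le[of "{..<l}"] by simp
  moreover have "d * l < K" by (simp add: K_def)
  moreover have "length xs \<noteq> d" if "set xs \<subseteq> ?X" "descending 1 (factor w 1) xs" for xs
    using descending_imp_divisible[OF that(2)] that(1) ndiv \<open>0 < d\<close> inside by fastforce
  ultimately obtain c where c: "c + S \<le> 0 + K * (S + 1)" "card (factor w 1 ` {c..<c + S}) \<le> d"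
    using interval_with_few_values[OF refl] by metis
  obtain c' where "card (factor w (2 ^ t * 1) ` {c'..<c' + d * (d + 1)}) \<le> d"
    and "c' + d * (d + 1) + 2 ^ t * 1 \<le> length w"
    by (rule refine_scale[of d w 1 c t]) (use ndiv assms(1) c inside in \<open>auto simp: S_def\<close>)
  then show "has_power d w"
    using assms(1,2) by (intro few_factors_has_power) auto
qed

section \<open>The linearised identity\<close>

text \<open>Letting words act by left multiplication gives a meaning to the empty word in a ring without
  unit. Annihilating every element is weaker than being zero; the difference costs a single
  factor in the final product.\<close>

definition act :: "('i \<Rightarrow> 'a::ring) \<Rightarrow> 'i list \<Rightarrow> 'a \<Rightarrow> 'a" where
  "act g w z = foldr (\<lambda>i y. g i * y) w z"

lemma act_simps [simp]:
  "act g [] z = z" "act g (i # w) z = g i * act g w z"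
  "act g (v @ w) z = act g v (act g w z)"
  by (simp_all add: act_def)

lemma act_zero [simp]: "act g w 0 = 0"
  by (induction w) auto

lemma act_add: "act g w (y + z) = act g w y + act g w z"
  by (induction w) (auto simp: distrib_left)

lemma act_sum: "act g w (\<Sum>i\<in>I. f i) = (\<Sum>i\<in>I. act g w (f i))"
  by (induction I rule: infinite_finite_induct) (auto simp: act_add)

lemma nonempty_prod_append: "nonempty_prod (xs @ [z]) = act id xs z"
  by (induction xs rule: induct_list012) auto

lemma nonempty_prod_mult: "w \<noteq> [] \<Longrightarrow> nonempty_prod (map g w) * z = act g w z"
  by (induction w rule: induct_list012) (auto simp: mult.assoc)

text \<open>Expansion of a power of a sum. Only the length of the list of units matters: it makes the
  power an action of a word in a single letter.\<close>

lemma act_replicate_sum: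
  fixes x :: "'i \<Rightarrow> 'a::ring"
  assumes "finite S"
  shows "act (\<lambda>_. \<Sum>i\<in>S. x i) (replicate n ()) z =
    (\<Sum>js | set js \<subseteq> S \<and> length js = n. act x js z)"
proof (induction n)
  case 0
  have "{js. set js \<subseteq> S \<and> length js = 0} = {[]}" by auto
  then show ?case by simp
next
  case (Suc n)
  let ?J = "\<lambda>n. {js. set js \<subseteq> S \<and> length js = n}"
  have "?J (Suc n) = (\<lambda>(i, js). i # js) ` (S \<times> ?J n)"
    by (auto simp: image_iff length_Suc_conv)
  moreover have "inj_on (\<lambda>(i, js). i # js) (S \<times> ?J n)" by (auto simp: inj_on_def)
  ultimately have "(\<Sum>js\<in>?J (Suc n). act x js z) = (\<Sum>(i, js)\<in>S \<times> ?J n. x i * act x js z)"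
    by (simp add: sum.reindex case_prod_unfold)
  also have "\<dots> = (\<Sum>i\<in>S. x i) * (\<Sum>js\<in>?J n. act x js z)"
    by (simp add: sum_product sum.cartesian_product)
  finally show ?case using Suc by simp
qed

text \<open>Expanding \<open>(\<Sum>i\<in>S. x i)\<^sup>n = 0\<close> and grouping the terms by the set \<open>T \<subseteq> S\<close> of indices that
  occur, the groups of all proper subsets vanish by induction, hence so does that of \<open>S\<close>. No
  coefficient is ever divided out, so this works in every characteristic. For \<open>card S = n\<close> the remaining terms
  are exactly the permutations of \<open>S\<close>.\<close>

lemma linearised_power:
  fixes x :: "'i \<Rightarrow> 'a::ring"
  assumes nil: "\<And>y::'a. nonunital_power y n = 0" and "0 < n" and "finite S"
  shows "(\<Sum>js | set js = S \<and> length js = n. act x js z) = 0"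
  using \<open>finite S\<close>
proof (induction S rule: finite_psubset_induct)
  case (psubset S)
  let ?G = "\<lambda>T. \<Sum>js | set js = T \<and> length js = n. act x js z"
  let ?J = "{js. set js \<subseteq> S \<and> length js = n}"
  have "(\<Sum>js\<in>?J. act x js z) = act (\<lambda>_. \<Sum>i\<in>S. x i) (replicate n ()) z"
    using act_replicate_sum[OF \<open>finite S\<close>] by metis
  also have "\<dots> = nonunital_power (\<Sum>i\<in>S. x i) n * z"
    using \<open>0 < n\<close> nonempty_prod_mult[of "replicate n ()" "\<lambda>_. \<Sum>i\<in>S. x i" z]
    by (simp add: nonunital_power_def)
  also have "\<dots> = 0" by (simp add: nil)
  finally have "0 = (\<Sum>js\<in>?J. act x js z)" by simp
  also have "\<dots> = (\<Sum>T\<in>Pow S. \<Sum>js | js \<in> ?J \<and> set js = T. act x js z)"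
    using \<open>finite S\<close> by (intro sum.group[symmetric]) (auto simp: finite_lists_length_eq)
  also have "\<dots> = (\<Sum>T\<in>Pow S. ?G T)"
    by (intro sum.cong refl arg_cong[where f = "sum _"]) auto
  also have "\<dots> = ?G S + (\<Sum>T\<in>Pow S - {S}. ?G T)"
    using \<open>finite S\<close> by (intro sum.remove) auto
  also have "(\<Sum>T\<in>Pow S - {S}. ?G T) = 0"
    using psubset.IH by (intro sum.neutral) auto
  finally show ?case by simp
qed

lemma first_displaced_index:
  assumes "set js = {..<n}" "length js = n" "js \<noteq> [0..<n]"
  obtains k j js' where "js = [0..<k] @ j # js'" "k < j" "j < n"
proof -
  have dist: "distinct js" using assms by (simp add: card_distinct)
  have "\<exists>k<n. js ! k \<noteq> k"
    using assms(2,3) by (auto intro: nth_equalityI)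
  then obtain k where k: "k < n" "js ! k \<noteq> k" and least: "\<And>i. i < k \<Longrightarrow> js ! i = i"
    using exists_least_iff[of "\<lambda>k. k < n \<and> js ! k \<noteq> k"] by (metis less_trans)
  have "take k js = [0..<k]"
    using k least assms(2) by (intro nth_equalityI) auto
  then have split: "js = [0..<k] @ js ! k # drop (Suc k) js"
    using k assms(2) id_take_nth_drop[of k js] by simp
  have "js ! k \<notin> {0..<k}" using dist split
    by (metis distinct_append disjoint_iff list.set_intros(1) set_upt)
  moreover have "js ! k < n" using assms k nth_mem by blast
  ultimately show thesis using that[OF split] k by auto
qed

text \<open>The first displaced factor is replaced by one that comes later in the chain, which it
  dominates; everything before it is unchanged.\<close>

lemma permuted_less:
  assumes sorted: "sorted_wrt dominates us"
    and js: "set js = {..<length us}" "length js = length us" "js \<noteq> [0..<length us]"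
  shows "concat (map ((!) us) js) @ s < concat us @ s"
proof -
  obtain k j js' where kj: "js = [0..<k] @ j # js'" "k < j" "j < length us"
    using first_displaced_index[OF js] .
  have "dominates (us ! k) (us ! j)" using sorted kj sorted_wrt_nth_less by blast
  then obtain a where a: "a \<le> length (us ! k)" "a \<le> length (us ! j)"
      "take a (us ! j) < take a (us ! k)"
    unfolding dominates_def by blast
  let ?p = "concat (take k us)"
  have pre: "map ((!) us) [0..<k] = take k us"
    using kj by (intro nth_equalityI) auto
  have less: "take a (us ! j) @ x < take a (us ! k) @ y" for x y
    using a unfolding list_less_def by (intro lexord_sufI) auto
  have "us = take k us @ us ! k # drop (Suc k) us" using kj id_take_nth_drop[of k us] by simp
  then have "concat us = ?p @ us ! k @ concat (drop (Suc k) us)"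
    by (metis concat.simps(2) concat_append)
  then have "concat us @ s = ?p @ take a (us ! k) @ drop a (us ! k) @ concat (drop (Suc k) us) @ s"
    by simp
  moreover have "concat (map ((!) us) js) @ s =
      ?p @ take a (us ! j) @ drop a (us ! j) @ concat (map ((!) us) js') @ s"
    using pre by (simp add: kj(1))
  ultimately show ?thesis
    using less unfolding list_less_def by (metis lexord_append_leftI)
qed

lemma act_concat:
  assumes "[] \<notin> set us" "set js \<subseteq> {..<length us}"
  shows "act g (concat (map ((!) us) js)) z = act (\<lambda>j. nonempty_prod (map g (us ! j))) js z"
  using assms
proof (induction js)
  case (Cons j js)
  then have "us ! j \<noteq> []" by (metis insert_subset lessThan_iff list.simps(15) nth_mem)
  then show ?case using Cons by (simp add: nonempty_prod_mult)
qed simp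

text \<open>Induction along the lexicographic order on words of a fixed length, which is well-founded. For a
  divisible word, the linearised identity is applied to the values of its \<open>d\<close> factors: all its
  terms but the identity permutation are smaller words, so the word itself acts as zero.\<close>

lemma long_words_act_zero:
  fixes g :: "nat \<Rightarrow> 'a::ring"
  assumes nil: "\<And>y::'a. nonunital_power y d = 0" and d: "0 < d" "d \<le> 2 ^ t"
    and "set w \<subseteq> {..<l}" "length w = word_bound d l t"
  shows "act g w z = 0"
  using assms(4-)
proof (induction w arbitrary: z rule: wf_induct_rule[OF wf_lex[OF wf_less_than]])
  case (1 w)
  from divisible_or_power[OF d "1.prems"] show ?case
  proof
    assume "has_power d w"
    then obtain v u v' where u: "u \<noteq> []" "w = v @ concat (replicate d u) @ v'"
      unfolding has_power_def by blast
    have "act g (concat (replicate d u)) y = act (\<lambda>_. nonempty_prod (map g u)) (replicate d ()) y" for y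
      by (induction d) (auto simp: nonempty_prod_mult[OF u(1)])
    also have "\<dots> y = nonunital_power (nonempty_prod (map g u)) d * y" for y
      using d(1) nonempty_prod_mult[of "replicate d ()" "\<lambda>_. nonempty_prod (map g u)" y]
      by (simp add: nonunital_power_def)
    finally show ?thesis using u nil by simp
  next
    assume "divisible d w"
    then obtain v us v' where w: "w = v @ concat us @ v'" and us: "length us = d" "[] \<notin> set us"
      "sorted_wrt dominates us" unfolding divisible_def by blast
    let ?x = "\<lambda>j. nonempty_prod (map g (us ! j))"
    let ?J = "{js. set js = {..<d} \<and> length js = d}"
    let ?y = "act g v' z"
    have fin: "finite ?J"
      by (rule finite_subset[OF _ finite_lists_length_eq[of "{..<d}" d]]) auto
    have other: "act g v (act ?x js ?y) = 0" if "js \<in> ?J - {[0..<d]}" for js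
    proof -
      let ?w' = "v @ concat (map ((!) us) js) @ v'"
      have "mset (map ((!) us) js) = mset (map ((!) us) [0..<d])"
      proof -
        have "distinct js" using that by (simp add: card_distinct)
        then have "mset js = mset [0..<d]"
          using that using mset_set_set[of js] by (simp add: atLeast0LessThan)
        then show ?thesis by (metis mset_map)
      qed
      then have perm: "mset (map ((!) us) js) = mset us" using us(1) map_nth by metis
      have len: "length ?w' = length w"
        using arg_cong[OF perm, of "\<lambda>M. sum_mset (image_mset length M)"]
        by (simp add: w length_concat sum_mset_sum_list[symmetric] del: map_map)
      have set: "set ?w' = set w"
        using arg_cong[OF perm, of set_mset] by (simp add: w)
      have "?w' < w"
        using permuted_less[OF us(3), of js v'] that us(1)
        unfolding w list_less_def by (intro lexord_append_leftI) auto
      then have "(?w', w) \<in> lex less_than"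
        using len by (simp add: list_less_def lexord_lex less_than_def less_eq[symmetric])
      moreover have "set ?w' \<subseteq> {..<l}" "length ?w' = word_bound d l t"
        unfolding len set by (fact "1.prems")+
      ultimately have "act g ?w' z = 0" by (rule "1.IH")
      then show ?thesis using act_concat[OF us(2), of js g] that us(1) by simp
    qed
    have "0 = act g v (\<Sum>js\<in>?J. act ?x js ?y)"
      using linearised_power[OF nil d(1), of "{..<d}"] by simp
    also have "\<dots> = (\<Sum>js\<in>?J. act g v (act ?x js ?y))" by (rule act_sum)
    also have "\<dots> = act g v (act ?x [0..<d] ?y) + (\<Sum>js\<in>?J - {[0..<d]}. act g v (act ?x js ?y))"
      using fin by (intro sum.remove) (auto simp: atLeast0LessThan)
    also have "(\<Sum>js\<in>?J - {[0..<d]}. act g v (act ?x js ?y)) = 0"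
      using other by (rule sum.neutral[OF ballI])
    finally have "act g v (act ?x [0..<d] ?y) = 0" by simp
    then show ?thesis
      using act_concat[OF us(2), of "[0..<d]" g ?y] us(1) map_nth[of us]
      by (simp add: w atLeast0LessThan)
  qed
qed

section \<open>From words in the generators to arbitrary products\<close>

text \<open>These sets increase with \<open>k\<close>, from \<open>{0}\<close> at \<open>k = 0\<close> to the whole ring at the length at which
  all words act as zero. Left multiplication by an element of the algebra moves down at least one
  level, because this holds for generators and is preserved by linear combinations and products.
  So a product of \<open>N\<close> arbitrary elements annihilates what all words of length \<open>N\<close> annihilate.\<close>

definition killed :: "(nat \<Rightarrow> 'a::ring) \<Rightarrow> nat \<Rightarrow> nat \<Rightarrow> 'a set" where
  "killed g l k = {z. \<forall>w. set w \<subseteq> {..<l} \<and> length w = k \<longrightarrow> act g w z = 0}"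

lemma killed_Suc: "z \<in> killed g l k \<Longrightarrow> z \<in> killed g l (Suc k)"
  by (auto simp: killed_def length_Suc_conv)

context assoc_algebra
begin

lemma act_scale: "act g w (scale c z) = scale c (act g w z)"
  by (induction w) (auto simp: scale_mult_right)

lemma mult_killed:
  fixes g :: "nat \<Rightarrow> 'a"
  assumes gen: "subalgebra scale hull (g ` {..<l}) = UNIV" and z: "z \<in> killed g l (Suc k)"
  shows "x * z \<in> killed g l k"
proof -
  have "x \<in> subalgebra scale hull (g ` {..<l})" using gen by simp
  then have "\<forall>z\<in>killed g l (Suc k). x * z \<in> killed g l k"
  proof (rule hull_induct)
    fix x assume "x \<in> g ` {..<l}"
    then obtain i where i: "i < l" "x = g i" by auto
    have "act g w (x * z) = 0" if "z \<in> killed g l (Suc k)" "set w \<subseteq> {..<l}" "length w = k" for w z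
    proof -
      have "set (w @ [i]) \<subseteq> {..<l}" "length (w @ [i]) = Suc k" using that(2,3) i by auto
      with that(1) have "act g (w @ [i]) z = 0" unfolding killed_def by blast
      then show ?thesis using i by simp
    qed
    then show "\<forall>z\<in>killed g l (Suc k). x * z \<in> killed g l k" unfolding killed_def by blast
  next
    let ?S = "{x. \<forall>z\<in>killed g l (Suc k). x * z \<in> killed g l k}"
    have "subspace ?S"
      by (rule subspaceI)
        (auto simp: killed_def distrib_right act_add scale_mult_left act_scale)
    moreover have "x * y \<in> ?S" if "x \<in> ?S" "y \<in> ?S" for x y
    proof -
      have "x * (y * z) \<in> killed g l k" if "z \<in> killed g l (Suc k)" for z
        using that \<open>x \<in> ?S\<close> \<open>y \<in> ?S\<close> killed_Suc[of "y * z" g l k] by blast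
      then show ?thesis by (simp add: mult.assoc)
    qed
    ultimately show "subalgebra scale ?S" unfolding subalgebra_def by blast
  qed
  then show ?thesis using z by blast
qed

lemma products_vanish_if_words_act_zero:
  fixes g :: "nat \<Rightarrow> 'a"
  assumes gen: "subalgebra scale hull (g ` {..<l}) = UNIV"
    and zero: "\<And>w z. set w \<subseteq> {..<l} \<Longrightarrow> length w = N \<Longrightarrow> act g w z = 0"
  shows "products_vanish (UNIV :: 'a set) (Suc N)"
proof -
  have step: "act id xs z \<in> killed g l k" if "z \<in> killed g l (length xs + k)" for xs z k
    using that
  proof (induction xs arbitrary: k)
    case (Cons x xs)
    then show ?case using mult_killed[OF gen] by simp
  qed simp
  have "act id xs z \<in> killed g l 0" if "length xs = N" for xs and z :: 'a
    by (rule step) (use that zero in \<open>simp add: killed_def\<close>)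
  then have "act id xs z = 0" if "length xs = N" for xs and z :: 'a
    using that by (simp add: killed_def)
  then have "nonempty_prod (xs @ [z]) = 0" if "length xs = N" for xs and z :: 'a
    using that by (simp add: nonempty_prod_append)
  then show ?thesis
    unfolding products_vanish_def length_Suc_conv_rev by blast
qed

end

section \<open>The numerical estimate\<close>

text \<open>Adding \<open>2 * a\<close> absorbs the additive terms of the recursion, so that each doubling just
  multiplies the bound by \<open>d\<^sup>3 + 1\<close>.\<close>

lemma sufficient_length_le:
  assumes "0 < d"
  shows "sufficient_length d a t + 2 * a \<le> (d ^ 3 + 1) ^ t * (d * (d + 1) + 2 * 2 ^ t * a)"
proof (induction t arbitrary: a)
  case (Suc t)
  let ?K = "d ^ 3 + 1" and ?S = "sufficient_length d (2 * a) t"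
  have "2 \<le> ?K" using assms by simp
  then have "2 * (2 * a) \<le> ?K * (2 * a)" by (rule mult_le_mono1)
  then have "sufficient_length d a (Suc t) + 2 * a \<le> ?K * (?S + 2 * (2 * a))"
    by (simp add: algebra_simps)
  also have "\<dots> \<le> ?K * (?K ^ t * (d * (d + 1) + 2 * 2 ^ t * (2 * a)))"
    using Suc by (rule mult_le_mono2)
  also have "\<dots> = ?K ^ Suc t * (d * (d + 1) + 2 * 2 ^ Suc t * a)"
    by (simp only: power_Suc mult_ac)
  finally show ?case .
qed simp

lemma word_bound_le:
  assumes "0 < d" "0 < l" "2 ^ t \<le> 2 * d"
  shows "word_bound d l t + 1 \<le> 26 * l * d ^ 4 * d ^ (3 * t)"
proof -
  have d1: "1 \<le> d ^ k" for k using assms(1) by simp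
  have "sufficient_length d 1 t + 1 \<le> (d ^ 3 + 1) ^ t * (d * (d + 1) + 2 * 2 ^ t)"
    using sufficient_length_le[OF assms(1), of 1 t] by simp
  also have "\<dots> \<le> (2 * d ^ 3) ^ t * (6 * d ^ 2)"
  proof (intro mult_le_mono power_mono)
    show "d ^ 3 + 1 \<le> 2 * d ^ 3" using d1[of 3] by simp
    have "d \<le> d * d" using assms(1) by simp
    then show "d * (d + 1) + 2 * 2 ^ t \<le> 6 * d ^ 2"
      using assms(3) unfolding power2_eq_square distrib_left by linarith
  qed simp
  also have "\<dots> = 2 ^ t * (6 * d ^ 2 * d ^ (3 * t))"
    unfolding power_mult_distrib power_mult by (simp only: mult_ac)
  also have "\<dots> \<le> 2 * d * (6 * d ^ 2 * d ^ (3 * t))"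
    using assms(3) by (rule mult_le_mono1)
  also have "\<dots> = 12 * d ^ 3 * d ^ (3 * t)" by (simp add: power3_eq_cube power2_eq_square)
  finally have S: "sufficient_length d 1 t + 1 \<le> 12 * d ^ 3 * d ^ (3 * t)" .
  have "d * l + 1 \<le> 2 * (d * l)" using assms(1,2) by (simp add: Suc_leI)
  then have "word_bound d l t + 1 \<le> 2 * (d * l) * (12 * d ^ 3 * d ^ (3 * t)) + 2"
    unfolding word_bound_def using mult_le_mono[OF _ S, of "d * l + 1" "2 * (d * l)"] by linarith
  also have "\<dots> = 24 * (l * d ^ 4 * d ^ (3 * t)) + 2"
    by (simp add: power4_eq_xxxx power3_eq_cube)
  also have "1 \<le> l * d ^ 4 * d ^ (3 * t)"
    using assms(1,2) by (simp add: Suc_leI)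
  then have "24 * (l * d ^ 4 * d ^ (3 * t)) + 2 \<le> 26 * l * d ^ 4 * d ^ (3 * t)" by simp
  finally show ?thesis .
qed

lemma quasipolynomial_less_Psi:
  assumes "0 < d" "0 < l" "2 ^ t \<le> 2 * d"
  shows "real (26 * l * d ^ 4 * d ^ (3 * t)) < Psi d d l"
proof -
  let ?L = "log 3 (real d)"
  have d1: "1 \<le> real d" using assms(1) by simp
  have L0: "0 \<le> ?L" using d1 by simp
  have "log 2 (3::real) \<le> log 2 (2 ^ 2)" by (subst log_le_cancel_iff) auto
  then have log2_3: "log 2 (3::real) \<le> 2" by (simp only: log_pow_cancel)
  have log34: "0 \<le> log 3 (4::real)" by simp
  have "real t = log 2 (2 ^ t)" by simp
  also have "\<dots> \<le> log 2 (2 * real d)"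
    using assms(1,3) of_nat_mono[OF assms(3), where ?'a = real] by (subst log_le_cancel_iff) auto
  also have "\<dots> = 1 + log 2 (real d)" using assms(1) by (simp add: log_mult)
  also have "log 2 (real d) = log 2 3 * ?L"
    by (simp add: log_def)
  also have "\<dots> \<le> 2 * ?L" using log2_3 L0 by (rule mult_right_mono)
  finally have t: "real t \<le> 1 + 2 * ?L" by simp
  have "real (d ^ 4 * d ^ (3 * t)) = real d ^ (4 + 3 * t)" by (simp only: of_nat_mult of_nat_power power_add)
  also have "\<dots> = real d powr (4 + 3 * real t)"
    using powr_realpow[of "real d" "4 + 3 * t"] d1 by simp
  also have "\<dots> \<le> real d powr (2 * (6 * ?L + (5 + 6 * log 3 4)))"
  proof (rule powr_mono)
    show "4 + 3 * real t \<le> 2 * (6 * ?L + (5 + 6 * log 3 4))"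
      using t L0 log34 unfolding distrib_left by linarith
  qed (rule d1)
  also have "\<dots> = real (d * d) powr (3 * log 3 (real (d * d)) + (5 + 6 * log 3 4))"
  proof -
    have square: "real (d * d) = real d powr 2"
      using d1 by (simp add: powr_numeral power2_eq_square)
    have "log 3 (real (d * d)) = 2 * ?L"
      using d1 by (simp add: log_mult)
    then show ?thesis unfolding square powr_powr by simp
  qed
  finally have P: "real (d ^ 4 * d ^ (3 * t)) \<le> \<dots>" .
  have "(26::real) < 4 powr 5" by simp
  also have "\<dots> \<le> 4 powr (5 + 3 * log 3 4)"
    using zero_le_log_cancel_iff[of 3 4] by (intro powr_mono) auto
  finally have four: "26 < (4::real) powr (5 + 3 * log 3 4)" .
  let ?D = "real (d ^ 4 * d ^ (3 * t))"
  have pos: "0 < real l * ?D" using assms(1,2) by simp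
  have "real (26 * l * d ^ 4 * d ^ (3 * t)) = 26 * (real l * ?D)"
    by (simp only: of_nat_mult of_nat_numeral mult.assoc)
  also have "\<dots> < 4 powr (5 + 3 * log 3 4) * (real l * ?D)"
    using four pos by (rule mult_strict_right_mono)
  also have "\<dots> = 4 powr (5 + 3 * log 3 4) * real l * ?D * 1"
    by (simp only: mult.assoc mult_1_right)
  also have "\<dots> \<le> Psi d d l"
    unfolding Psi_def by (intro mult_mono P one_le_power d1 order_refl) simp_all
  finally show ?thesis .
qed

lemma power_of_two_between:
  assumes "0 < (d::nat)"
  obtains t where "d \<le> 2 ^ t" "2 ^ t \<le> 2 * d"
proof -
  define t where "t = (LEAST t. d \<le> 2 ^ t)"
  have "d \<le> 2 ^ d" by (simp add: less_imp_le)
  then have t: "d \<le> 2 ^ t" unfolding t_def by (rule LeastI)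
  have "2 ^ t \<le> 2 * d"
  proof (cases t)
    case 0
    then show ?thesis using assms by simp
  next
    case (Suc s)
    then have "\<not> d \<le> 2 ^ s" using not_less_Least[of s "\<lambda>t. d \<le> 2 ^ t"] by (simp add: t_def)
    then show ?thesis using Suc by simp
  qed
  with t show thesis by (rule that)
qed

theorem corollary1p5:
  fixes scale :: "'k::field \<Rightarrow> 'a::ring \<Rightarrow> 'a" and l d :: nat
  assumes "l > 0" and "d > 0"
    and "assoc_algebra scale"
    and "generated_by scale l"
    and "\<And>x::'a. nonunital_power x d = 0"
  shows "nilpotent (UNIV :: 'a set) \<and> real (nilpotency_index (UNIV :: 'a set)) < Psi d d l"
proof -
  obtain g where gen: "subalgebra scale hull (g ` {..<l}) = UNIV"
    using assms(4) unfolding generated_by_def by blast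
  obtain t where t: "d \<le> 2 ^ t" "2 ^ t \<le> 2 * d"
    using power_of_two_between[OF \<open>d > 0\<close>] .
  let ?N = "word_bound d l t"
  have vanish: "products_vanish (UNIV :: 'a set) (Suc ?N)"
    using assoc_algebra.products_vanish_if_words_act_zero[OF assms(3) gen]
      long_words_act_zero[OF assms(5,2) t(1)] by blast
  then have "nilpotency_index (UNIV :: 'a set) \<le> Suc ?N"
    unfolding nilpotency_index_def by (intro Least_le) simp
  also have "\<dots> \<le> 26 * l * d ^ 4 * d ^ (3 * t)"
    using word_bound_le[OF assms(2,1) t(2)] by simp
  finally have "real (nilpotency_index (UNIV :: 'a set)) \<le> real (26 * l * d ^ 4 * d ^ (3 * t))"
    by (rule of_nat_mono)
  also have "\<dots> < Psi d d l" using quasipolynomial_less_Psi[OF assms(2,1) t(2)] .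
  finally show ?thesis using vanish unfolding nilpotent_def by blast
qed

end
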